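(* For every $d\ge 1$ there exists $u\in\mathbb{R}^d\setminus\{0\}$ such that the hyperplane $u^\perp=\{x\mid\langle u,x\rangle=0\}$ contains no vertex of $C_d=[-1,1]^d$ and the $(d-1)$-dimensional polytope $C_d\cap u^\perp$ has exactly $\left\lceil \tfrac{d}{2}\right\rceil\binom{d}{\lceil d/2\rceil}$ vertices.
   Context: It is known (O'Neil) that $\left\lceil \tfrac{d}{2}\right\rceil\binom{d}{\lceil d/2\rceil}$ is an upper bound on the number of vertices of any $(d-1)$-dimensional polytope $C_d\cap H$ with $H$ an affine hyperplane; the theorem states this bound is attained by a hyperplane through the origin containing no vertex of the cube. *)

theory Defs
  imports "HOL-Analysis.Analysis"
begin

definition cube :: "(real ^ 'n) set"
  where "cube = {x. \<forall>i. -1 \<le> x $ i \<and> x $ i \<le> 1}"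

definition orth_hyperplane :: "real ^ 'n \<Rightarrow> (real ^ 'n) set"
  where "orth_hyperplane u = {x. u \<bullet> x = 0}"

text \<open>The vertices of a polytope are its zero-dimensional faces, i.e. its extreme points
  (cf. face_of_singleton).\<close>

definition vertices :: "(real ^ 'n) set \<Rightarrow> (real ^ 'n) set"
  where "vertices P = {v. v extreme_point_of P}"

end

theory Submission
  imports Defs
begin

text \<open>
  Let \<open>k = \<lceil>d/2\<rceil>\<close>. Take all coordinates of \<open>u\<close> equal to 1, except that for even \<open>d\<close> one
  coordinate is \<open>3/2\<close>. Then no sign vector is orthogonal to \<open>u\<close>, and the vertices of the section
  are the points where an edge of the cube crosses the hyperplane. Identify a sign vector with the
  set \<open>B\<close> of its positive coordinates: it lies on the positive side of the hyperplane if
  \<open>card B > k\<close> and on the negative side if \<open>card B < k\<close>, so every crossing edge has exactly one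
  endpoint \<open>B\<close> with \<open>card B = k\<close>. If \<open>B\<close> is on the positive side, the crossing edges at \<open>B\<close> are
  those which flip an element of \<open>B\<close>, otherwise those which flip an element of the complement;
  in both cases there are \<open>k\<close> of them.
\<close>

text \<open>\<open>v\<close> is the midpoint of \<open>v - w\<close> and \<open>v + w\<close>. Both
  non-extremality arguments below reduce to finding such a perturbation \<open>w\<close>.\<close>

lemma not_extreme_point_of_symmetric:
  fixes v w :: "'a::real_vector"
  assumes "v + w \<in> P" "v - w \<in> P" "w \<noteq> 0"
  shows "\<not> v extreme_point_of P"
proof
  assume v: "v extreme_point_of P"
  have eq: "v = midpoint (v - w) (v + w)"
    by (simp add: midpoint_def)
  have "v - w \<noteq> v + w"
  proof
    assume "v - w = v + w"
    then have "(2::real) *\<^sub>R w = 0"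
      by (simp add: scaleR_2 algebra_simps)
    with \<open>w \<noteq> 0\<close> show False by simp
  qed
  then have "v \<in> open_segment (v - w) (v + w)"
    by (subst eq) (simp only: midpoint_in_open_segment not_False_eq_True)
  then show False
    using v assms by (auto simp: extreme_point_of_def)
qed

section \<open>Vertices of the cube and of its central sections\<close>

lemma cube_eq_cbox: "cube = cbox (- 1) (1 :: real ^ 'n)"
  by (auto simp: cube_def mem_box_cart)

lemma mem_cube_iff: "x \<in> cube \<longleftrightarrow> (\<forall>i. \<bar>x $ i\<bar> \<le> 1)"
  by (auto simp: cube_def abs_le_iff minus_le_iff)

text \<open>A coordinate strictly between -1 and 1 leaves room to move both ways along its
  axis.\<close>

lemma vertices_cube_subset: "vertices (cube :: (real ^ 'n) set) \<subseteq> {x. \<forall>j. \<bar>x $ j\<bar> = 1}"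
proof (rule subsetI, rule CollectI, rule allI, rule ccontr)
  fix x :: "real ^ 'n" and j
  assume x: "x \<in> vertices cube" and ne: "\<bar>x $ j\<bar> \<noteq> 1"
  have cube: "-1 \<le> x $ i \<and> x $ i \<le> 1" for i
    using x by (auto simp: vertices_def extreme_point_of_def cube_def)
  define w :: "real ^ 'n" where "w = axis j (1 - \<bar>x $ j\<bar>)"
  have "\<bar>(x + w) $ i\<bar> \<le> 1" "\<bar>(x - w) $ i\<bar> \<le> 1" for i
    using cube[of i] unfolding w_def axis_def by (cases "i = j"; simp; linarith)+
  then have "x + w \<in> cube" "x - w \<in> cube"
    by (simp_all add: mem_cube_iff)
  moreover have "w \<noteq> 0"
    using ne by (simp add: w_def axis_eq_0_iff)
  ultimately show False
    using x not_extreme_point_of_symmetric by (auto simp: vertices_def)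
qed

text \<open>Two free coordinates would allow a perturbation inside the hyperplane, and
  \<open>avoid\<close> excludes having none. Conversely, an edge in direction \<open>i\<close> is
  transversal to the hyperplane because \<open>u $ i\<close> is nonzero.\<close>

lemma vertices_cube_section:
  fixes u :: "real ^ 'n"
  assumes nz: "\<And>i. u $ i \<noteq> 0"
    and avoid: "\<And>x. (\<forall>j. \<bar>x $ j\<bar> = 1) \<Longrightarrow> u \<bullet> x \<noteq> 0"
  shows "vertices (cube \<inter> orth_hyperplane u) =
    {x. u \<bullet> x = 0 \<and> (\<exists>i. \<bar>x $ i\<bar> < 1 \<and> (\<forall>j. j \<noteq> i \<longrightarrow> \<bar>x $ j\<bar> = 1))}" (is "?V = ?R")
proof (rule set_eqI, rule iffI)
  fix x assume x: "x \<in> ?V"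
  then have cube: "\<bar>x $ i\<bar> \<le> 1" for i
    by (auto simp: vertices_def extreme_point_of_def mem_cube_iff)
  have ux: "u \<bullet> x = 0"
    using x by (auto simp: vertices_def extreme_point_of_def orth_hyperplane_def)
  obtain i where i: "\<bar>x $ i\<bar> < 1"
    using avoid[of x] ux cube by (meson less_eq_real_def)
  have "\<bar>x $ j\<bar> = 1" if "j \<noteq> i" for j
  proof (rule ccontr)
    assume "\<bar>x $ j\<bar> \<noteq> 1"
    then have j: "\<bar>x $ j\<bar> < 1" using cube[of j] by simp
    \<comment> \<open>\<open>m\<close> is the slack common to both coordinates; \<open>c\<close> is
      scaled so that \<open>c * \<bar>u $ i\<bar>\<close> and \<open>c * \<bar>u $ j\<bar>\<close>
      add up to it.\<close>
    define m where "m = min (1 - \<bar>x $ i\<bar>) (1 - \<bar>x $ j\<bar>)"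
    define c where "c = m / (\<bar>u $ i\<bar> + \<bar>u $ j\<bar>)"
    have m: "0 < m" "m \<le> 1 - \<bar>x $ i\<bar>" "m \<le> 1 - \<bar>x $ j\<bar>"
      using i j by (auto simp: m_def)
    have den: "0 < \<bar>u $ i\<bar> + \<bar>u $ j\<bar>"
      using nz[of i] by simp
    have c: "0 < c" using m den by (simp add: c_def)
    have "c * \<bar>u $ i\<bar> + c * \<bar>u $ j\<bar> = m"
      using den by (simp add: c_def flip: distrib_left add_divide_distrib)
    moreover have "0 \<le> c * \<bar>u $ i\<bar>" "0 \<le> c * \<bar>u $ j\<bar>"
      using c by auto
    ultimately have "\<bar>c * u $ i\<bar> \<le> m" "\<bar>c * u $ j\<bar> \<le> m"
      using c by (auto simp: abs_mult)
    then have bi: "\<bar>x $ i\<bar> + \<bar>c * u $ j\<bar> \<le> 1" and bj: "\<bar>x $ j\<bar> + \<bar>c * u $ i\<bar> \<le> 1"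
      using m by auto
    \<comment> \<open>Swapping two entries of \<open>u\<close> and negating one gives a direction
      orthogonal to \<open>u\<close>.\<close>
    define w where "w = axis i (c * u $ j) - axis j (c * u $ i)"
    have w: "w $ l = (if l = i then c * u $ j else if l = j then - (c * u $ i) else 0)" for l
      using that by (auto simp: w_def axis_def)
    have "\<bar>(x + w) $ l\<bar> \<le> 1" "\<bar>(x - w) $ l\<bar> \<le> 1" for l
      using bi bj cube[of l] by (auto simp: w)
    then have "x + w \<in> cube" "x - w \<in> cube"
      by (simp_all add: mem_cube_iff)
    moreover have "u \<bullet> w = 0"
      by (simp add: w_def inner_diff_right inner_axis)
    then have "x + w \<in> orth_hyperplane u" "x - w \<in> orth_hyperplane u"
      using ux by (auto simp: orth_hyperplane_def inner_diff_right inner_add_right)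
    moreover have "w \<noteq> 0"
      using w[of i] c nz[of j] by auto
    ultimately show False
      using x not_extreme_point_of_symmetric[of x w "cube \<inter> orth_hyperplane u"]
      by (simp add: vertices_def)
  qed
  then show "x \<in> ?R" using ux i by auto
next
  fix x assume "x \<in> ?R"
  then obtain i where ux: "u \<bullet> x = 0" and i: "\<bar>x $ i\<bar> < 1"
    and one: "\<And>j. j \<noteq> i \<Longrightarrow> \<bar>x $ j\<bar> = 1" by auto
  have cube: "\<bar>x $ j\<bar> \<le> 1" for j
    using i one[of j] by (cases "j = i") auto
  have "x \<in> cube \<inter> orth_hyperplane u"
    using ux cube by (auto simp: mem_cube_iff orth_hyperplane_def)
  moreover have "x \<notin> open_segment a b"
    if a: "a \<in> cube \<inter> orth_hyperplane u" and b: "b \<in> cube \<inter> orth_hyperplane u" for a b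
  proof
    assume "x \<in> open_segment a b"
    then obtain t where ab: "a \<noteq> b" and t: "0 < t" "t < 1"
      and x: "x = (1 - t) *\<^sub>R a + t *\<^sub>R b"
      by (auto simp: in_segment)
    have eq: "a $ j = b $ j" if "j \<noteq> i" for j
    proof -
      have comb: "x $ j = (1 - t) * a $ j + t * b $ j" by (simp add: x)
      have le: "a $ j \<le> 1" "b $ j \<le> 1" "-1 \<le> a $ j" "-1 \<le> b $ j"
        using a b by (auto simp: cube_def)
      \<comment> \<open>A proper convex combination of numbers in [-1,1] reaches an end of the
        interval only if both numbers do.\<close>
      consider "x $ j = 1" | "x $ j = -1" using one[OF \<open>j \<noteq> i\<close>] by linarith
      then show ?thesis
      proof cases
        case 1
        then have "(1 - t) * (1 - a $ j) + t * (1 - b $ j) = 0"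
          using comb by (simp add: algebra_simps)
        moreover have "0 \<le> (1 - t) * (1 - a $ j)" "0 \<le> t * (1 - b $ j)"
          using t le by auto
        ultimately have "(1 - t) * (1 - a $ j) = 0" "t * (1 - b $ j) = 0"
          by linarith+
        then show ?thesis using t by simp
      next
        case 2
        then have "(1 - t) * (1 + a $ j) + t * (1 + b $ j) = 0"
          using comb by (simp add: algebra_simps)
        moreover have "0 \<le> (1 - t) * (1 + a $ j)" "0 \<le> t * (1 + b $ j)"
          using t le by auto
        ultimately have "(1 - t) * (1 + a $ j) = 0" "t * (1 + b $ j) = 0"
          by linarith+
        then show ?thesis using t by simp
      qed
    qed
    then have diff: "a - b = axis i (a $ i - b $ i)"
      by (auto simp: vec_eq_iff axis_def)
    have "u \<bullet> (a - b) = 0"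
      using a b by (auto simp: orth_hyperplane_def inner_diff_right)
    then have "a $ i = b $ i"
      using nz[of i] by (subst (asm) diff) (simp add: inner_axis)
    then have "a = b" using eq by (metis vec_eq_iff)
    with ab show False by simp
  qed
  ultimately show "x \<in> ?V"
    by (auto simp: vertices_def extreme_point_of_def)
qed

section \<open>Counting the vertices of a section\<close>

definition sign_vec :: "'n set \<Rightarrow> real ^ 'n"
  where "sign_vec B = (\<chi> j. if j \<in> B then 1 else - 1)"

lemma sign_vec_nth [simp]: "sign_vec B $ j = (if j \<in> B then 1 else - 1)"
  by (simp add: sign_vec_def)

lemma sign_vec_cases:
  assumes "\<forall>j. \<bar>x $ j\<bar> = 1"
  obtains B where "x = sign_vec B"
proof
  show "x = sign_vec {j. x $ j = 1}"
    unfolding vec_eq_iff using assms by (auto simp: abs_if split: if_splits)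
qed

text \<open>The vertices correspond to pairs of a \<open>k\<close>-set \<open>B\<close> and a
  coordinate whose flip crosses the hyperplane. By \<open>small\<close>, one flip towards the
  hyperplane always crosses it; \<open>gt\<close> and \<open>lt\<close> place an endpoint of every
  crossing edge on level \<open>k\<close>; \<open>compl\<close> makes the number of flips
  \<open>k\<close> on the negative side too.\<close>

lemma card_vertices_cube_section:
  fixes u :: "real ^ 'n" and k :: nat
  assumes pos: "\<And>i. 0 < u $ i"
    and nz: "\<And>B. u \<bullet> sign_vec B \<noteq> 0"
    and small: "\<And>B i. card B = k \<Longrightarrow> \<bar>u \<bullet> sign_vec B\<bar> < 2 * u $ i"
    and gt: "\<And>B. k < card B \<Longrightarrow> 0 < u \<bullet> sign_vec B"
    and lt: "\<And>B. card B < k \<Longrightarrow> u \<bullet> sign_vec B < 0"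
    and compl: "\<And>B. card B = k \<Longrightarrow> u \<bullet> sign_vec B < 0 \<Longrightarrow> card (- B) = k"
  shows "card (vertices (cube \<inter> orth_hyperplane u)) = k * (CARD('n) choose k)"
proof -
  \<comment> \<open>As \<open>u\<close> is positive, \<open>T B\<close> collects the coordinates
    whose flip moves \<open>sign_vec B\<close> towards the hyperplane.\<close>
  define T where "T B = (if 0 < u \<bullet> sign_vec B then B else - B)" for B
  define S where "S = Sigma {B. card B = k} T"
  \<comment> \<open>The point where the hyperplane meets the line through \<open>sign_vec B\<close> in direction \<open>i\<close>.\<close>
  define g where "g = (\<lambda>(B, i). sign_vec B - axis i (u \<bullet> sign_vec B / u $ i))"
  have g_nth: "g (B, i) $ j = sign_vec B $ j - (if j = i then u \<bullet> sign_vec B / u $ i else 0)" for B i j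
    by (simp add: g_def axis_def)
  have free: "\<bar>g (B, i) $ i\<bar> < 1" if "(B, i) \<in> S" for B i
  proof -
    have B: "card B = k" and i: "i \<in> T B" using that by (auto simp: S_def)
    \<comment> \<open>For \<open>i\<close> in \<open>T B\<close>, \<open>q\<close> has the sign of
      the coordinate being flipped, so 0 < \<bar>\<open>q\<close>\<bar> < 2 puts the new coordinate
      strictly between -1 and 1.\<close>
    define q where "q = u \<bullet> sign_vec B / u $ i"
    have "\<bar>q\<bar> < 2"
      using small[OF B, of i] pos[of i] by (simp add: q_def abs_divide divide_less_eq)
    moreover have "0 < q \<longleftrightarrow> 0 < u \<bullet> sign_vec B"
      using pos[of i] by (simp add: q_def zero_less_divide_iff)
    moreover have "q \<noteq> 0"
      using nz[of B] less_imp_neq[OF pos[of i]] by (simp add: q_def)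
    ultimately show ?thesis
      using i by (auto simp: g_nth T_def simp flip: q_def split: if_splits)
  qed
  have fixed: "\<bar>g (B, i) $ j\<bar> = 1" if "j \<noteq> i" for B i j
    using that by (simp add: g_nth)
  have V: "vertices (cube \<inter> orth_hyperplane u) =
      {x. u \<bullet> x = 0 \<and> (\<exists>i. \<bar>x $ i\<bar> < 1 \<and> (\<forall>j. j \<noteq> i \<longrightarrow> \<bar>x $ j\<bar> = 1))}"
    using pos nz by (intro vertices_cube_section) (auto simp: less_imp_neq[symmetric] elim: sign_vec_cases)
  have "inj_on g S"
  proof (rule inj_onI, clarify)
    fix B i B' i'
    assume S: "(B, i) \<in> S" "(B', i') \<in> S" and eq: "g (B, i) = g (B', i')"
    \<comment> \<open>The direction is recovered as the only coordinate of absolute value below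
      1.\<close>
    have i: "i = i'"
      using free[OF S(1)] fixed[of i i' B'] eq by force
    have card: "card B = card B'" using S by (simp add: S_def)
    have "j \<in> B \<longleftrightarrow> j \<in> B'" if "j \<noteq> i" for j
      using arg_cong[OF eq, of "\<lambda>x. x $ j"] that i by (auto simp: g_nth split: if_splits)
    then have "B - {i} = B' - {i}" by auto
    \<comment> \<open>Membership of \<open>i\<close> itself is settled by the equal
      cardinalities.\<close>
    then have "B = B'"
      using card by (metis Diff_empty Diff_insert0 card_Suc_Diff1 finite insert_Diff n_not_Suc_n)
    then show "B = B' \<and> i = i'" using i by simp
  qed
  moreover have "g ` S = vertices (cube \<inter> orth_hyperplane u)"
  proof (rule equalityI, clarify)
    fix B i assume "(B, i) \<in> S"
    moreover have "u \<bullet> g (B, i) = 0"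
      using pos[of i] by (simp add: g_def inner_diff_right inner_axis)
    ultimately show "g (B, i) \<in> vertices (cube \<inter> orth_hyperplane u)"
      unfolding V using free fixed by blast
  next
    show "vertices (cube \<inter> orth_hyperplane u) \<subseteq> g ` S"
    proof
      fix x assume "x \<in> vertices (cube \<inter> orth_hyperplane u)"
      then obtain i where ux: "u \<bullet> x = 0" and i: "\<bar>x $ i\<bar> < 1"
        and one: "\<And>j. j \<noteq> i \<Longrightarrow> \<bar>x $ j\<bar> = 1" unfolding V by auto
      \<comment> \<open>\<open>A\<close> and \<open>insert i A\<close> are the endpoints of the cube
        edge through \<open>x\<close>, on the negative and the positive side respectively.\<close>
      define A where "A = {j. j \<noteq> i \<and> x $ j = 1}"
      have iA: "i \<notin> A" by (simp add: A_def)
      have x_nth: "x $ j = (if j \<in> A then 1 else - 1)" if "j \<noteq> i" for j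
        using one[OF that] that by (auto simp: A_def)
      have sA: "sign_vec A = x - axis i (1 + x $ i)"
        using x_nth iA by (auto simp: vec_eq_iff axis_def)
      have sI: "sign_vec (insert i A) = x + axis i (1 - x $ i)"
        using x_nth by (auto simp: vec_eq_iff axis_def)
      have uA: "u \<bullet> sign_vec A = - (u $ i * (1 + x $ i))"
        by (simp add: sA inner_diff_right inner_axis ux)
      have uI: "u \<bullet> sign_vec (insert i A) = u $ i * (1 - x $ i)"
        by (simp add: sI inner_add_right inner_axis ux)
      have neg: "u \<bullet> sign_vec A < 0"
        unfolding uA using i pos[of i] by (simp add: abs_less_iff)
      have posI: "0 < u \<bullet> sign_vec (insert i A)"
        unfolding uI using i pos[of i] by (simp add: abs_less_iff)
      have "card A \<le> k" using gt[of A] neg by force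
      moreover have "k \<le> Suc (card A)"
        using lt[of "insert i A"] posI iA by force
      ultimately consider "card A = k" | "card (insert i A) = k"
        using iA by force
      then show "x \<in> g ` S"
      proof cases
        case 1
        then have "(A, i) \<in> S" using neg iA by (simp add: S_def T_def)
        moreover have "x = g (A, i)"
          using pos[of i] less_imp_neq[OF pos[of i]] unfolding g_def by (simp add: uA vec_eq_iff) (simp add: sA axis_def x_nth iA)
        ultimately show ?thesis by blast
      next
        case 2
        then have "(insert i A, i) \<in> S" using posI by (simp add: S_def T_def)
        moreover have "x = g (insert i A, i)"
          using pos[of i] less_imp_neq[OF pos[of i]] unfolding g_def by (simp add: uI vec_eq_iff) (simp add: axis_def x_nth)
        ultimately show ?thesis by blast
      qed
    qed
  qed
  ultimately have "card (vertices (cube \<inter> orth_hyperplane u)) = card S"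
    by (metis card_image)
  also have "\<dots> = (\<Sum>B\<in>{B. card B = k}. card (T B))"
    by (simp add: S_def)
  also have "\<dots> = (\<Sum>B\<in>{B :: 'n set. card B = k}. k)"
    using compl nz by (intro sum.cong) (auto simp: T_def not_less order_less_le)
  also have "\<dots> = k * (CARD('n) choose k)"
    using n_subsets[of "UNIV :: 'n set" k] by simp
  finally show ?thesis .
qed

section \<open>Dimension of the section\<close>

lemma aff_dim_cube_section:
  fixes u :: "real ^ 'n"
  assumes "u \<noteq> 0"
  shows "aff_dim (cube \<inter> orth_hyperplane u) = int CARD('n) - 1"
proof -
  \<comment> \<open>The origin is a common point, so cutting with the cube keeps the full dimension
    of the hyperplane.\<close>
  have "orth_hyperplane u \<inter> interior cube \<noteq> {}"
    unfolding ex_in_conv[symmetric] by (rule exI[of _ 0])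
       (simp add: orth_hyperplane_def cube_eq_cbox interior_cbox mem_box_cart)
  then have "aff_dim (orth_hyperplane u \<inter> cube) = aff_dim (orth_hyperplane u)"
    by (intro aff_dim_convex_Int_nonempty_interior)
      (simp_all add: orth_hyperplane_def convex_hyperplane)
  then show ?thesis
    using aff_dim_hyperplane[OF assms, of 0] by (simp add: orth_hyperplane_def Int_commute)
qed

lemma polytope_cube_section: "polytope (cube \<inter> orth_hyperplane u)"
  unfolding cube_eq_cbox orth_hyperplane_def
  by (intro polytope_Int_polyhedron polytope_interval polyhedron_hyperplane)

section \<open>Choice of the normal vector\<close>

theorem theorem2p7:
  shows "\<exists>u :: real ^ 'n. u \<noteq> 0 \<and>
    orth_hyperplane u \<inter> vertices cube = {} \<and>
    polytope (cube \<inter> orth_hyperplane u) \<and>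
    aff_dim (cube \<inter> orth_hyperplane u) = int CARD('n) - 1 \<and>
    card (vertices (cube \<inter> orth_hyperplane u)) =
      nat \<lceil>real CARD('n) / 2\<rceil> * (CARD('n) choose nat \<lceil>real CARD('n) / 2\<rceil>)"
proof -
  define d where "d = CARD('n)"
  define k where "k = nat \<lceil>real d / 2\<rceil>"
  have dk: "even d \<Longrightarrow> d = 2 * k" "odd d \<Longrightarrow> d + 1 = 2 * k"
  proof -
    show "d = 2 * k" if "even d" using that by (auto simp: k_def)
    show "d + 1 = 2 * k" if "odd d"
    proof -
      obtain b where b: "d = 2 * b + 1" using \<open>odd d\<close> by (elim oddE)
      have "\<lceil>real d / 2\<rceil> = int b + 1" unfolding b by (rule ceiling_unique) auto
      then show ?thesis using b by (simp add: k_def)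
    qed
  qed
  fix p :: 'n
  \<comment> \<open>For odd \<open>d\<close> a sum of \<open>d\<close> signs is odd, hence nonzero;
    for even \<open>d\<close> the extra 1/2 at an arbitrary \<open>p\<close> breaks the ties of
    balanced sign vectors.\<close>
  define u :: "real ^ 'n" where "u = 1 + axis p (if even d then 1/2 else 0)"
  have u_nth: "u $ j = 1 + (if j = p \<and> even d then 1/2 else 0)" for j
    by (simp add: u_def axis_def)
  have sum_sign: "(1 :: real ^ 'n) \<bullet> sign_vec B = 2 * real (card B) - real d" for B
  proof -
    have "(1 :: real ^ 'n) \<bullet> sign_vec B = (\<Sum>j\<in>UNIV. if j \<in> B then 1 else - 1)"
      by (simp add: inner_vec_def)
    also have "\<dots> = (\<Sum>j\<in>UNIV. 2 * indicator B j - 1)"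
      by (intro sum.cong) auto
    also have "\<dots> = 2 * real (card B) - real d"
      by (simp add: sum_subtractf d_def indicator_def flip: sum_distrib_left)
    finally show ?thesis .
  qed
  \<comment> \<open>\<open>e B\<close> is the value of \<open>u \<bullet> sign_vec B\<close> on
    level \<open>k\<close>; for odd \<open>d\<close> it is 2\<open>k\<close> - \<open>d\<close> = 1.
    Off that level the even term has absolute value at least 2 and outweighs it.\<close>
  define e where "e B = (if odd d then 1 else if p \<in> B then 1/2 else - (1/2) :: real)" for B
  have us: "u \<bullet> sign_vec B = 2 * (real (card B) - real k) + e B" for B
    using dk by (auto simp: u_def inner_add_left sum_sign inner_axis' e_def)
  have e: "e B \<noteq> 0" "\<bar>e B\<bar> \<le> 1" for B by (auto simp: e_def)
  have gt: "0 < u \<bullet> sign_vec B" if "k < card B" for B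
    using of_nat_mono[OF Suc_leI[OF that], where ?'a = real] e(2)[of B] unfolding us by simp
  have lt: "u \<bullet> sign_vec B < 0" if "card B < k" for B
    using of_nat_mono[OF Suc_leI[OF that], where ?'a = real] e(2)[of B] unfolding us by simp
  have nz: "u \<bullet> sign_vec B \<noteq> 0" for B
    using gt[of B] lt[of B] e(1)[of B] us[of B] by (cases "card B" k rule: linorder_cases) auto
  have "card (vertices (cube \<inter> orth_hyperplane u)) = k * (CARD('n) choose k)"
  proof (rule card_vertices_cube_section[OF _ nz _ gt lt])
    show "0 < u $ i" for i by (simp add: u_nth)
    show "\<bar>u \<bullet> sign_vec B\<bar> < 2 * u $ i" if "card B = k" for B i
      using e(2)[of B] that by (simp add: us u_nth)
    show "card (- B) = k" if B: "card B = k" "u \<bullet> sign_vec B < 0" for B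
    proof -
      \<comment> \<open>For odd \<open>d\<close> level \<open>k\<close> lies on the positive side.
        For even \<open>d\<close> = 2\<open>k\<close>, complements of \<open>k\<close>-sets are
        again \<open>k\<close>-sets.\<close>
      have "even d" using B by (auto simp: us e_def split: if_splits)
      then show ?thesis using dk B by (simp add: Compl_eq_Diff_UNIV card_Diff_subset d_def)
    qed
  qed
  moreover have "orth_hyperplane u \<inter> vertices cube = {}"
    using vertices_cube_subset nz by (fastforce simp: orth_hyperplane_def elim: sign_vec_cases)
  moreover have "u \<noteq> 0" using nz[of "{}"] by auto
  ultimately show ?thesis
    using polytope_cube_section aff_dim_cube_section unfolding k_def d_def by blast
qed

end
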